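(* Assume that $x\in[0,1]$ is a counterexample to the $2$-adic Littlewood conjecture, and let $w(x,2)$ be its base-$2$ expansion. Then the lengths of the overlap-free subwords of $w(x,2)$ are bounded; that is, there is a constant $L$ such that every overlap-free subword of $w(x,2)$ has length at most $L$.
   Context: A real number $x$ is a counterexample to the $2$-adic Littlewood conjecture (2LC) if $\liminf_{q\to\infty} q\cdot|q|_2\cdot\|qx\|\neq0$, where $q$ runs over the positive integers, $|\cdot|_2$ is the $2$-adic absolute value and $\|\cdot\|$ is the distance to the nearest integer. Such $x$ is irrational. For irrational $x\in[0,1]$, $w(x,2)=a_1a_2\cdots$ is the unique infinite word on $\{0,1\}$ with $x=\sum_{i\ge1}a_i2^{-i}$. Subwords are blocks of consecutive letters. A word over an alphabet $\mathcal{A}$ is overlap-free if it contains no subword of the form $uXuXu$ with $u\in\mathcal{A}$ a letter and $X\in\mathcal{A}^*$ a (possibly empty) finite word. *)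

theory Defs
  imports "HOL-Analysis.Analysis" "HOL-Library.Sublist"
begin

definition padic_abs :: "nat \<Rightarrow> nat \<Rightarrow> real" where
  "padic_abs p q = (if q = 0 then 0 else 1 / real p ^ multiplicity p q)"

(* The filter "sequentially" ignores the irrelevant value at q = 0.  The limit inferior is taken
   in the extended reals, so it exists without any boundedness side condition.  The distance to
   the nearest integer is "infdist" to the set of integers. *)
definition counterexample_2LC :: "real \<Rightarrow> bool" where
  "counterexample_2LC x \<longleftrightarrow>
     liminf (\<lambda>q::nat. ereal (real q * padic_abs 2 q * infdist (real q * x) \<int>)) \<noteq> 0"

(* Infinite words are functions on nat, indexed from 0, so letter i carries weight b ^ -(i+1).
   Only meaningful for irrational x in [0,1] (and b > 1), where the expansion exists and is
   unique; otherwise the description operator may return an unspecified word. *)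
definition base_expansion :: "real \<Rightarrow> nat \<Rightarrow> (nat \<Rightarrow> nat)" where
  "base_expansion x b =
     (THE a. (\<forall>i. a i < b) \<and> (\<lambda>i. real (a i) / real b ^ (i + 1)) sums x)"

definition subword :: "'a list \<Rightarrow> (nat \<Rightarrow> 'a) \<Rightarrow> bool" where
  "subword v w \<longleftrightarrow> (\<exists>i j. v = map w [i..<j])"

definition overlap_free :: "'a list \<Rightarrow> bool" where
  "overlap_free v \<longleftrightarrow> \<not> (\<exists>u X. sublist ([u] @ X @ [u] @ X @ [u]) v)"

end

theory Submission
  imports Defs
begin

text \<open>If the digits of \<open>x\<close> satisfy \<open>a\<^sub>j + a\<^sub>j\<^sub>+\<^sub>m = 1\<close> for \<open>s \<le> j < s + 2m\<close>, that is, if the expansion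
  contains a block \<open>v v' v\<close> with \<open>v'\<close> the complement of \<open>v\<close> and \<open>|v| = m\<close>, then
  \<open>q = 2\<^sup>s (2\<^sup>m + 1)\<close> satisfies \<open>\<parallel>q x\<parallel> \<le> 4\<^sup>-\<^sup>m\<close>: adding \<open>2\<^sup>s x\<close> and \<open>2\<^sup>s\<^sup>+\<^sup>m x\<close> produces \<open>2m\<close> consecutive
  ones. As \<open>|q|\<^sub>2 = 2\<^sup>-\<^sup>s\<close>, the Littlewood product is at most \<open>2\<^sup>1\<^sup>-\<^sup>m\<close>.

  Such blocks with \<open>m = 2\<^sup>k\<close> occur in every long overlap-free word. Away from its ends, an
  overlap-free binary word has all its squares of letters at positions of the same parity, so
  that it is the image of an overlap-free word, half as long, under the Thue-Morse morphism;
  this morphism doubles \<open>m\<close>.\<close>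

section \<open>Overlap-free binary words\<close>

text \<open>An overlap \<open>uXuXu\<close> is a factor of length \<open>2 * d + 1\<close> with
  period \<open>d = |uX|\<close>; here \<open>p\<close> is its first position. With words as
  functions, passing to every second letter is plain reindexing.\<close>

definition overlap_free_upto :: "(nat \<Rightarrow> 'a) \<Rightarrow> nat \<Rightarrow> bool" where
  "overlap_free_upto w N \<longleftrightarrow> \<not> (\<exists>p d. 0 < d \<and> p + 2 * d < N \<and> (\<forall>t\<le>d. w (p + t) = w (p + t + d)))"

lemma overlap_free_uptoD:
  assumes "overlap_free_upto w N" "0 < d" "p + 2 * d < N"
  shows "\<exists>t\<le>d. w (p + t) \<noteq> w (p + t + d)"
  using assms unfolding overlap_free_upto_def by blast

lemma overlap_free_upto_mono:
  assumes "overlap_free_upto w N" "M \<le> N"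
  shows "overlap_free_upto w M"
  using assms unfolding overlap_free_upto_def by (meson order_less_le_trans)

lemma overlap_free_imp_upto:
  assumes "overlap_free (map w [i..<j])"
  shows "overlap_free_upto (\<lambda>t. w (i + t)) (j - i)"
  unfolding overlap_free_upto_def
proof clarify
  fix p d
  assume d: "0 < d" and p: "p + 2 * d < j - i"
    and eq: "\<forall>t\<le>d. w (i + (p + t)) = w (i + (p + t + d))"
  define l where "l = i + p"
  define X where "X = map w [Suc l..<l + d]"
  have first: "map w [l..<l + d] = w l # X"
    unfolding X_def using d by (simp add: upt_conv_Cons)
  have per: "w (t + d) = w t" if "l \<le> t" "t \<le> l + d" for t
    using eq[rule_format, of "t - l"] that by (simp add: l_def algebra_simps)
  have second: "map w [l + d..<l + d + d] = w l # X"
    unfolding first[symmetric]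
  proof (rule nth_equalityI)
    fix i assume "i < length (map w [l + d..<l + d + d])"
    then show "map w [l + d..<l + d + d] ! i = map w [l..<l + d] ! i"
      using per[of "l + i"] by (simp add: algebra_simps)
  qed simp
  have third: "w (l + 2 * d) = w l"
    using per[of l] per[of "l + d"] by (simp add: mult_2 add.assoc)
  have "[i..<j] = [i..<l] @ [l..<l + d] @ [l + d..<l + d + d] @ [l + 2 * d] @ [l + 2 * d + 1..<j]"
  proof -
    have "[i..<j] = [i..<l] @ [l..<j]"
      using upt_add_eq_append[of i l "j - l"] p by (simp add: l_def)
    also have "[l..<j] = [l..<l + d] @ [l + d..<j]"
      using upt_add_eq_append[of l "l + d" "j - (l + d)"] p by (simp add: l_def)
    also have "[l + d..<j] = [l + d..<l + d + d] @ [l + d + d..<j]"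
      using upt_add_eq_append[of "l + d" "l + d + d" "j - (l + d + d)"] p by (simp add: l_def)
    also have "[l + d + d..<j] = [l + 2 * d] @ [l + 2 * d + 1..<j]"
      using p by (simp add: l_def upt_conv_Cons mult_2 add.assoc)
    finally show ?thesis .
  qed
  then have "map w [i..<j] =
      map w [i..<l] @ ([w l] @ X @ [w l] @ X @ [w l]) @ map w [l + 2 * d + 1..<j]"
    using first second third by simp
  then have "sublist ([w l] @ X @ [w l] @ X @ [w l]) (map w [i..<j])"
    unfolding sublist_def by blast
  with assms show False
    unfolding overlap_free_def by blast
qed

section \<open>Positions of squares of letters in overlap-free binary words\<close>

context
  fixes w :: "nat \<Rightarrow> bool" and N :: nat
  assumes of: "overlap_free_upto w N"
begin

lemma no_cube:
  assumes "i + 2 < N" "w i = w (i + 1)"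
  shows "w (i + 1) \<noteq> w (i + 2)"
  using overlap_free_uptoD[OF of, of 1 i] assms by (auto simp: le_Suc_eq)

text \<open>Five alternating letters \<open>ababa\<close> form an overlap with
  \<open>d = 2\<close>.\<close>

lemma no_alternation:
  assumes "i + 4 < N" "w i \<noteq> w (i + 1)" "w (i + 1) \<noteq> w (i + 2)" "w (i + 2) \<noteq> w (i + 3)"
  shows "w (i + 3) = w (i + 4)"
  using overlap_free_uptoD[OF of, of 2 i] assms
  by (auto simp: le_Suc_eq numeral_2_eq_2 numeral_3_eq_3 eval_nat_numeral)

text \<open>Since cubes are forbidden, two squares at distance 3 force the letters from
  \<open>i - 1\<close> to \<open>i + 5\<close> to be \<open>baabaab\<close>, an overlap with
  \<open>d = 3\<close>. The hypotheses on \<open>i\<close> provide the outer letters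
  \<open>b\<close>.\<close>

lemma square_distance_3:
  assumes "1 \<le> i" "i + 5 < N" "w i = w (i + 1)"
  shows "w (i + 3) \<noteq> w (i + 4)"
proof
  assume sq: "w (i + 3) = w (i + 4)"
  obtain h where h: "i = Suc h" using assms by (cases i) auto
  have "w (i + 1) \<noteq> w (i + 2)" "w h \<noteq> w i" "w (i + 2) \<noteq> w (i + 3)" "w (i + 4) \<noteq> w (i + 5)"
    using no_cube[of i] no_cube[of h] no_cube[of "i + 2"] no_cube[of "i + 3"] assms sq h
    by (auto simp: eval_nat_numeral)
  then have "\<forall>t\<le>3. w (h + t) = w (h + t + 3)"
    using assms sq h by (auto simp: le_Suc_eq eval_nat_numeral)
  then show False
    using overlap_free_uptoD[OF of, of 3 h] assms h by auto
qed

text \<open>Positions \<open>i + 1\<close> and \<open>i + 3\<close> carry no square. Without one at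
  \<open>i + 2\<close> either, the letters from \<open>i + 1\<close> to \<open>i + 4\<close>
  alternate, and the alternation has to stop at \<open>i + 4\<close>.\<close>

lemma next_square:
  assumes "1 \<le> i" "i + 5 < N" "w i = w (i + 1)"
  shows "w (i + 2) = w (i + 3) \<or> w (i + 4) = w (i + 5)"
  using no_cube[of i] square_distance_3[of i] no_alternation[of "i + 1"] assms
  by (auto simp: eval_nat_numeral)

lemma squares_same_parity:
  assumes "1 \<le> i" "i < j" "j + 2 < N" "w i = w (i + 1)" "w j = w (j + 1)"
  shows "even (j - i)"
  using assms
proof (induction "j - i" arbitrary: i rule: less_induct)
  case less
  show ?case
  proof (rule ccontr)
    assume odd: "odd (j - i)"
    \<comment> \<open>An odd distance is thus at least 5, so the next square, at
      \<open>i + 2\<close> or \<open>i + 4\<close>, lies before \<open>j\<close>, and the induction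
      hypothesis applies to it.\<close>
    have "j \<noteq> i + 1" "j \<noteq> i + 3"
      using no_cube[of i] square_distance_3[of i] less.prems by (auto simp: eval_nat_numeral)
    with odd less.prems(2) have far: "i + 5 \<le> j"
      by presburger
    then consider "w (i + 2) = w (i + 2 + 1)" | "w (i + 4) = w (i + 4 + 1)"
      using next_square[of i] less.prems by (auto simp: eval_nat_numeral)
    then show False
    proof cases
      case 1
      then have "even (j - (i + 2))"
        using less.hyps[of "i + 2"] less.prems far by simp
      with odd far show False by presburger
    next
      case 2
      then have "even (j - (i + 4))"
        using less.hyps[of "i + 4"] less.prems far by simp
      with odd far show False by presburger
    qed
  qed
qed

text \<open>Pairs are cut at the parity opposite to that of the squares, so each square straddles
  two pairs and each pair has distinct letters. Offset 0 is avoided because a square at position 0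
  has no left neighbour and its parity is not controlled.\<close>

lemma Thue_Morse_parsing:
  obtains e where "e \<in> {1, 2}" "\<And>n. e + 2 * n + 2 < N \<Longrightarrow> w (e + 2 * n) \<noteq> w (e + 2 * n + 1)"
proof (cases "\<exists>i. 1 \<le> i \<and> i + 2 < N \<and> w i = w (i + 1)")
  case False
  show ?thesis by (rule that[of 1]) (use False in auto)
next
  case True
  then obtain i where i: "1 \<le> i" "i + 2 < N" "w i = w (i + 1)" by blast
  have par: "even j \<longleftrightarrow> even i" if "1 \<le> j" "j + 2 < N" "w j = w (j + 1)" for j
    using squares_same_parity[of i j] squares_same_parity[of j i] that i
    by (cases i j rule: linorder_cases) auto
  show ?thesis
  proof (rule that[of "if even i then 1 else 2"])
    fix n
    let ?e = "if even i then 1 else 2 :: nat"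
    assume "?e + 2 * n + 2 < N"
    then show "w (?e + 2 * n) \<noteq> w (?e + 2 * n + 1)"
      using par[of "?e + 2 * n"] by (auto split: if_splits)
  qed auto
qed

text \<open>With neither cubes nor alternating triples, exactly one of any two consecutive pairs of
  neighbours is a square. Letters at distance 2 then differ, the word has period 4, and its first
  nine letters form an overlap.\<close>

lemma alternating_triple:
  assumes "11 \<le> N"
  shows "\<exists>s. s + 3 \<le> N \<and> w s \<noteq> w (s + 1) \<and> w (s + 1) \<noteq> w (s + 2)"
proof (rule ccontr)
  assume "\<not> ?thesis"
  then have no: "w s = w (s + 1) \<or> w (s + 1) = w (s + 2)" if "s + 3 \<le> N" for s
    using that by blast
  have step: "w (s + 2) \<noteq> w s" if "s + 2 < N" for s
    using no[of s] no_cube[of s] that by auto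
  have "w (s + 4) = w s" if "s + 4 < N" for s
    using step[of s] step[of "s + 2"] that by (auto simp: eval_nat_numeral)
  then show False
    using overlap_free_uptoD[OF of, of 4 0] assms by (auto simp: add.commute)
qed

end

text \<open>The morphism turns an overlap of period \<open>d\<close> into one of period
  \<open>2 * d\<close>: letters at even offsets are copied, and those at odd offsets are the
  complements of their left neighbours.\<close>

lemma Thue_Morse_preimage_overlap_free:
  fixes w :: "nat \<Rightarrow> bool"
  assumes "overlap_free_upto w N" "e + 2 * M \<le> N"
    and ne: "\<And>n. n < M \<Longrightarrow> w (e + 2 * n) \<noteq> w (e + 2 * n + 1)"
  shows "overlap_free_upto (\<lambda>n. w (e + 2 * n)) M"
  unfolding overlap_free_upto_def
proof clarify
  fix p d
  assume d: "0 < d" "p + 2 * d < M" and eq: "\<forall>t\<le>d. w (e + 2 * (p + t)) = w (e + 2 * (p + t + d))"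
  have "w (e + 2 * p + t) = w (e + 2 * p + t + 2 * d)" if "t \<le> 2 * d" for t
  proof (cases "even t")
    case True
    then obtain r where "t = 2 * r" by blast
    then show ?thesis using eq[rule_format, of r] that by (simp add: algebra_simps)
  next
    case False
    then obtain r where r: "t = 2 * r + 1" by (blast elim: oddE)
    then have "r < d" using that by simp
    then show ?thesis
      using eq[rule_format, of r] ne[of "p + r"] ne[of "p + r + d"] d r
      by (auto simp: algebra_simps)
  qed
  then show False
    using overlap_free_uptoD[OF assms(1), of "2 * d" "e + 2 * p"] d assms(2) by auto
qed

text \<open>The bound \<open>N\<close> is uniform in \<open>w\<close>, as the induction hypothesis
  is applied to the preimage of \<open>w\<close>. The block found there, of length
  \<open>3 * 2 ^ k\<close>, has an image of twice that length and the same shape.\<close>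

lemma complement_block_exists:
  "\<exists>N. \<forall>w :: nat \<Rightarrow> bool. overlap_free_upto w N \<longrightarrow>
     (\<exists>s. s + 3 * 2 ^ k \<le> N \<and> (\<forall>j<2 * 2 ^ k. w (s + j) \<noteq> w (s + j + 2 ^ k)))"
proof (induction k)
  case 0
  show ?case
  proof (rule exI[of _ 11], intro allI impI)
    fix w :: "nat \<Rightarrow> bool"
    assume "overlap_free_upto w 11"
    from alternating_triple[OF this] obtain s
      where "s + 3 \<le> 11" "w s \<noteq> w (s + 1)" "w (s + 1) \<noteq> w (s + 2)" by auto
    then show "\<exists>s. s + 3 * 2 ^ 0 \<le> 11 \<and> (\<forall>j<2 * 2 ^ 0. w (s + j) \<noteq> w (s + j + 2 ^ 0))"
      by (intro exI[of _ s]) (auto simp: less_Suc_eq eval_nat_numeral)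
  qed
next
  case (Suc k)
  then obtain M where M: "\<And>w :: nat \<Rightarrow> bool. overlap_free_upto w M \<Longrightarrow>
     \<exists>s. s + 3 * 2 ^ k \<le> M \<and> (\<forall>j<2 * 2 ^ k. w (s + j) \<noteq> w (s + j + 2 ^ k))"
    by blast
  define m :: nat where "m = 2 ^ k"
  show ?case
  \<comment> \<open>The surplus 4 absorbs the offset \<open>e <= 2\<close> and the margin that
    \<open>Thue_Morse_parsing\<close> leaves at the right end.\<close>
  proof (rule exI[of _ "2 * M + 4"], intro allI impI)
    fix w :: "nat \<Rightarrow> bool"
    assume of: "overlap_free_upto w (2 * M + 4)"
    obtain e where e: "e \<in> {1, 2}"
      and "\<And>n. e + 2 * n + 2 < 2 * M + 4 \<Longrightarrow> w (e + 2 * n) \<noteq> w (e + 2 * n + 1)"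
      using Thue_Morse_parsing[OF of] by blast
    then have ne: "w (e + 2 * n) \<noteq> w (e + 2 * n + 1)" if "n < M" for n
      using that by auto
    have "overlap_free_upto (\<lambda>n. w (e + 2 * n)) M"
      using Thue_Morse_preimage_overlap_free[OF of _ ne] e by auto
    from M[OF this] obtain s where s: "s + 3 * m \<le> M"
      and anti: "\<And>j. j < 2 * m \<Longrightarrow> w (e + 2 * (s + j)) \<noteq> w (e + 2 * (s + j + m))"
      by (auto simp: m_def)
    have "w (e + 2 * s + j) \<noteq> w (e + 2 * s + j + 2 * m)" if "j < 2 * (2 * m)" for j
    proof (cases "even j")
      case True
      then obtain i where "j = 2 * i" by blast
      then show ?thesis using anti[of i] that by (simp add: algebra_simps)
    next
      case False
      then obtain i where "j = 2 * i + 1" by (blast elim: oddE)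
      then show ?thesis
        using anti[of i] ne[of "s + i"] ne[of "s + i + m"] that s by (auto simp: algebra_simps)
    qed
    then show "\<exists>s. s + 3 * 2 ^ Suc k \<le> 2 * M + 4 \<and>
        (\<forall>j<2 * 2 ^ Suc k. w (s + j) \<noteq> w (s + j + 2 ^ Suc k))"
      using s e by (intro exI[of _ "e + 2 * s"]) (auto simp: m_def)
  qed
qed

section \<open>Base expansions\<close>

text \<open>The upper bound compares with the series whose digits are all \<open>b - 1\<close>. The
  value 1 does occur; irrationality excludes it in \<open>floor_eq_irrational\<close>.\<close>

lemma expansion_bounds:
  fixes a :: "nat \<Rightarrow> nat"
  assumes b: "2 \<le> b" and a: "\<And>i. a i < b" and "(\<lambda>i. real (a i) / real b ^ (i + 1)) sums r"
  shows "0 \<le> r" "r \<le> 1"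
proof -
  show "0 \<le> r"
    by (rule sums_le[OF _ sums_zero assms(3)]) simp
  have "(\<lambda>i. (1 / real b) ^ i) sums (1 / (1 - 1 / real b))"
    using b by (intro geometric_sums) simp
  from sums_mult[OF this, of "(real b - 1) / real b"]
  have "(\<lambda>i. (real b - 1) / real b ^ (i + 1)) sums 1"
    using b by (simp add: field_simps)
  moreover have "real (a i) / real b ^ (i + 1) \<le> (real b - 1) / real b ^ (i + 1)" for i
    using a[of i] b by (intro divide_right_mono) auto
  ultimately show "r \<le> 1"
    by (intro sums_le[OF _ assms(3)])
qed

lemma floor_eq_irrational:
  fixes y :: real
  assumes "y \<notin> \<rat>" "y = of_int n + r" "0 \<le> r" "r \<le> 1"
  shows "\<lfloor>y\<rfloor> = n"
proof -
  have "r \<noteq> 1"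
    using assms(1,2) by (metis Rats_1 Rats_add Rats_of_int)
  with assms show ?thesis by (simp add: floor_eq_iff)
qed

lemma irrational_power_mult:
  fixes x :: real
  assumes "x \<notin> \<rat>" "2 \<le> (b::nat)"
  shows "real b ^ n * x \<notin> \<rat>"
proof
  assume "real b ^ n * x \<in> \<rat>"
  then have "real b ^ n * x / real b ^ n \<in> \<rat>"
    by (intro Rats_divide Rats_power) auto
  with assms show False by simp
qed

text \<open>This yields uniqueness: any expansion of \<open>x\<close> has its digits determined by
  floors, since multiplying by \<open>b ^ n\<close> splits \<open>x\<close> into an integer and a
  tail in [0,1].\<close>

lemma expansion_digit_eq_floor:
  fixes a :: "nat \<Rightarrow> nat"
  assumes x: "x \<notin> \<rat>" and b: "2 \<le> b" and a: "\<And>i. a i < b"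
    and sums: "(\<lambda>i. real (a i) / real b ^ (i + 1)) sums x"
  shows "int (a n) = \<lfloor>real b ^ (n + 1) * x\<rfloor> - int b * \<lfloor>real b ^ n * x\<rfloor>"
proof -
  have tail: "\<exists>r. (\<lambda>i. real (a (n + i)) / real b ^ (i + 1)) sums r \<and>
      real b ^ n * x = of_int \<lfloor>real b ^ n * x\<rfloor> + r" for n
  proof -
    \<comment> \<open>\<open>?N\<close> is the integer written in base \<open>b\<close> by the first
      \<open>n\<close> digits; \<open>?r\<close> is the value of the remaining tail.\<close>
    let ?N = "\<Sum>i<n. int (a i) * int b ^ (n - 1 - i)"
    let ?r = "real b ^ n * x - of_int ?N"
    have "(\<lambda>i. real (a (i + n)) / real b ^ (i + n + 1)) sums
        (x - (\<Sum>i<n. real (a i) / real b ^ (i + 1)))"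
      using sums_split_initial_segment[OF sums, of n] by simp
    from sums_mult[OF this, of "real b ^ n"]
    have "(\<lambda>i. real (a (n + i)) / real b ^ (i + 1)) sums
        (real b ^ n * x - real b ^ n * (\<Sum>i<n. real (a i) / real b ^ (i + 1)))"
      using b by (simp add: power_add field_simps)
    moreover have "real b ^ n * (\<Sum>i<n. real (a i) / real b ^ (i + 1)) = of_int ?N"
      unfolding sum_distrib_left of_int_sum
    proof (rule sum.cong)
      fix i assume "i \<in> {..<n}"
      then have "real b ^ n = real b ^ (n - 1 - i) * real b ^ (i + 1)"
        by (subst power_add[symmetric]) simp
      then show "real b ^ n * (real (a i) / real b ^ (i + 1)) =
          of_int (int (a i) * int b ^ (n - 1 - i))"
        using b by simp
    qed simp
    ultimately have r: "(\<lambda>i. real (a (n + i)) / real b ^ (i + 1)) sums ?r"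
      by simp
    moreover have "\<lfloor>real b ^ n * x\<rfloor> = ?N"
      using irrational_power_mult[OF x b] expansion_bounds[OF b _ r] a
      by (intro floor_eq_irrational[of _ _ ?r]) auto
    ultimately show ?thesis by auto
  qed
  obtain r where r: "(\<lambda>i. real (a (n + i)) / real b ^ (i + 1)) sums r"
    "real b ^ n * x = of_int \<lfloor>real b ^ n * x\<rfloor> + r" using tail by blast
  obtain r' where r': "(\<lambda>i. real (a (n + 1 + i)) / real b ^ (i + 1)) sums r'"
    "real b ^ (n + 1) * x = of_int \<lfloor>real b ^ (n + 1) * x\<rfloor> + r'" using tail by blast
  \<comment> \<open>Multiplying the tail by \<open>b\<close> moves its leading digit
    \<open>a n\<close> in front of the point and leaves the next tail.\<close>
  have "(\<lambda>i. real (a (n + i)) / real b ^ i) sums (real b * r)"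
    using sums_mult[OF r(1), of "real b"] b by simp
  moreover have "(\<lambda>i. real (a (n + i)) / real b ^ i) sums (r' + real (a n))"
    using r'(1) by (subst sums_Suc_iff[symmetric, of "\<lambda>i. real (a (n + i)) / real b ^ i", simplified])
      (simp add: algebra_simps)
  ultimately have "real b * r = r' + real (a n)"
    by (rule sums_unique2)
  then have "real_of_int (int (a n)) =
      of_int (\<lfloor>real b ^ (n + 1) * x\<rfloor> - int b * \<lfloor>real b ^ n * x\<rfloor>)"
    using arg_cong[OF r(2), of "\<lambda>z. real b * z"] r'(2) by (simp add: algebra_simps)
  then show ?thesis
    by (simp only: of_int_eq_iff)
qed

section \<open>Existence of the expansion and its digits as differences of floors\<close>

lemma floor_digit_bounds:
  fixes y :: real
  assumes "2 \<le> (b::nat)"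
  shows "0 \<le> \<lfloor>real b * y\<rfloor> - int b * \<lfloor>y\<rfloor>" "\<lfloor>real b * y\<rfloor> - int b * \<lfloor>y\<rfloor> < int b"
proof -
  have "real b * of_int \<lfloor>y\<rfloor> \<le> real b * y"
    by (intro mult_left_mono) auto
  then have "int b * \<lfloor>y\<rfloor> \<le> \<lfloor>real b * y\<rfloor>"
    by (simp add: le_floor_iff)
  then show "0 \<le> \<lfloor>real b * y\<rfloor> - int b * \<lfloor>y\<rfloor>" by simp
  have "real b * y < real b * (of_int \<lfloor>y\<rfloor> + 1)"
    using assms by (intro mult_strict_left_mono) auto
  then have "\<lfloor>real b * y\<rfloor> < int b * (\<lfloor>y\<rfloor> + 1)"
    by (simp add: floor_less_iff)
  then show "\<lfloor>real b * y\<rfloor> - int b * \<lfloor>y\<rfloor> < int b"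
    by (simp add: algebra_simps)
qed

text \<open>The terms telescope: they are the differences of the truncations \<open>?S n\<close>,
  which converge to \<open>x\<close> and start at 0 because \<open>x\<close> lies in [0,1).\<close>

lemma floor_digits_sums:
  fixes x :: real
  assumes b: "2 \<le> (b::nat)" and "0 \<le> x" "x < 1"
  shows "(\<lambda>i. of_int (\<lfloor>real b ^ (i + 1) * x\<rfloor> - int b * \<lfloor>real b ^ i * x\<rfloor>) / real b ^ (i + 1)) sums x"
proof -
  let ?S = "\<lambda>n. of_int \<lfloor>real b ^ n * x\<rfloor> / real b ^ n"
  have "?S \<longlonglongrightarrow> x"
  proof (rule tendsto_sandwich[OF always_eventually always_eventually])
    have "(real b ^ n * x - 1) / real b ^ n \<le> ?S n" for n
      by (rule divide_right_mono) (linarith, simp)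
    moreover have "?S n \<le> real b ^ n * x / real b ^ n" for n
      by (rule divide_right_mono) simp_all
    ultimately show "\<forall>n. x - (1 / real b) ^ n \<le> ?S n" "\<forall>n. ?S n \<le> x"
      using b by (simp_all add: diff_divide_distrib power_one_over)
    have "(\<lambda>n. (1 / real b) ^ n) \<longlonglongrightarrow> 0"
      using b by (intro LIMSEQ_realpow_zero) auto
    from tendsto_diff[OF tendsto_const this]
    show "(\<lambda>n. x - (1 / real b) ^ n) \<longlonglongrightarrow> x" by simp
  qed simp
  from telescope_sums[OF this] have "(\<lambda>n. ?S (Suc n) - ?S n) sums (x - ?S 0)" .
  moreover have "?S 0 = 0"
    using assms by (simp add: floor_eq_iff)
  moreover have "?S (Suc n) - ?S n =
      of_int (\<lfloor>real b ^ (n + 1) * x\<rfloor> - int b * \<lfloor>real b ^ n * x\<rfloor>) / real b ^ (n + 1)" for n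
    using b by (simp add: field_simps)
  ultimately show ?thesis by simp
qed

lemma base_expansion_eq_floor:
  assumes x: "x \<notin> \<rat>" "x \<in> {0..1}" and b: "2 \<le> b"
  shows "int (base_expansion x b n) = \<lfloor>real b ^ (n + 1) * x\<rfloor> - int b * \<lfloor>real b ^ n * x\<rfloor>"
    and "base_expansion x b n < b"
proof -
  let ?P = "\<lambda>a :: nat \<Rightarrow> nat. (\<forall>i. a i < b) \<and> (\<lambda>i. real (a i) / real b ^ (i + 1)) sums x"
  define a where "a = (\<lambda>i. nat (\<lfloor>real b ^ (i + 1) * x\<rfloor> - int b * \<lfloor>real b ^ i * x\<rfloor>))"
  have x01: "0 \<le> x" "x < 1"
    using x by (auto simp: less_le)
  have a: "int (a i) = \<lfloor>real b ^ (i + 1) * x\<rfloor> - int b * \<lfloor>real b ^ i * x\<rfloor>" "a i < b" for i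
    using floor_digit_bounds[OF b, of "real b ^ i * x"] by (auto simp: a_def mult.assoc)
  have "real (a i) = of_int (\<lfloor>real b ^ (i + 1) * x\<rfloor> - int b * \<lfloor>real b ^ i * x\<rfloor>)" for i
    unfolding a(1)[symmetric] by simp
  then have "?P a"
    using floor_digits_sums[OF b x01] a(2) by simp
  moreover have "c = a" if "?P c" for c
  proof
    fix i
    have "int (c i) = int (a i)"
      using expansion_digit_eq_floor[OF x(1) b, of c i] that a(1) by simp
    then show "c i = a i" by simp
  qed
  ultimately have "base_expansion x b = a"
    unfolding base_expansion_def by (intro the_equality)
  with a show "int (base_expansion x b n) = \<lfloor>real b ^ (n + 1) * x\<rfloor> - int b * \<lfloor>real b ^ n * x\<rfloor>"
    "base_expansion x b n < b" by auto
qed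

section \<open>Littlewood products\<close>

lemma infdist_Ints_le: "infdist y \<int> \<le> \<bar>y - of_int n\<bar>" for y :: real
  using infdist_le[of "of_int n" \<int> y] by (simp add: dist_real_def)

text \<open>The products are nonnegative, so a nonzero limit inferior is positive, possibly
  infinite; any real \<open>c\<close> strictly between 0 and it will do.\<close>

lemma counterexample_2LC_bound:
  assumes "counterexample_2LC x"
  obtains c :: real where "0 < c"
    "eventually (\<lambda>q. c < real q * padic_abs 2 q * infdist (real q * x) \<int>) sequentially"
proof -
  let ?f = "\<lambda>q::nat. ereal (real q * padic_abs 2 q * infdist (real q * x) \<int>)"
  have "0 \<le> liminf ?f"
    by (intro Liminf_bounded always_eventually)
      (auto simp: padic_abs_def infdist_nonneg)
  with assms have "0 < liminf ?f"
    unfolding counterexample_2LC_def by (simp add: less_le)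
  then obtain c where c: "0 < ereal c" "ereal c < liminf ?f"
    using ereal_dense2 by blast
  show ?thesis
    by (rule that[of c]) (use c less_LiminfD[OF c(2)] in auto)
qed

lemma counterexample_2LC_irrational:
  assumes "counterexample_2LC x"
  shows "x \<notin> \<rat>"
proof
  assume "x \<in> \<rat>"
  then obtain m n where n: "n \<noteq> 0" and x: "x = of_int m / of_nat n"
    unfolding Rats_eq_int_div_nat by blast
  obtain c where "0 < c"
    "eventually (\<lambda>q. c < real q * padic_abs 2 q * infdist (real q * x) \<int>) sequentially"
    using counterexample_2LC_bound[OF assms] .
  then obtain Q where Q: "\<And>q. q \<ge> Q \<Longrightarrow> c < real q * padic_abs 2 q * infdist (real q * x) \<int>"
    by (auto simp: eventually_sequentially)
  \<comment> \<open>Multiples of the denominator give product 0; \<open>n * Q\<close> is one that is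
    at least \<open>Q\<close>.\<close>
  have "real (n * Q) * x = of_int (m * int Q)"
    using n by (simp add: x)
  then have "infdist (real (n * Q) * x) \<int> = 0"
    by (metis Ints_of_int infdist_zero)
  with Q[of "n * Q"] n \<open>0 < c\<close> show False by simp
qed

section \<open>Rational approximations from complement blocks\<close>

lemma padic_abs_power_mult_odd:
  assumes "odd r"
  shows "padic_abs 2 (2 ^ s * r) = 1 / 2 ^ s"
proof -
  have "multiplicity 2 (2 ^ s * r) = s"
    using assms by (intro multiplicity_decomposeI[of _ 2 s r]) auto
  moreover have "2 ^ s * r \<noteq> 0"
    using assms by (cases r) auto
  ultimately show ?thesis
    unfolding padic_abs_def by simp
qed

lemma complement_block_approximation:
  fixes x :: real
  assumes anti: "\<And>j. j < 2 * m \<Longrightarrow>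
      (\<lfloor>2 ^ (s + j + 1) * x\<rfloor> - 2 * \<lfloor>2 ^ (s + j) * x\<rfloor>) +
      (\<lfloor>2 ^ (s + j + m + 1) * x\<rfloor> - 2 * \<lfloor>2 ^ (s + j + m) * x\<rfloor>) = 1"
  shows "infdist (2 ^ s * (2 ^ m + 1) * x) \<int> \<le> 1 / 2 ^ (2 * m)"
proof -
  define A where "A i = \<lfloor>2 ^ i * x\<rfloor>" for i :: nat
  \<comment> \<open>Digits summing to 1 give the recurrence \<open>B -> 2 * B + 1\<close> for the
    sum of the two floors; adding 1 makes it a pure doubling.\<close>
  have sum: "A (s + k) + A (s + k + m) + 1 = 2 ^ k * (A s + A (s + m) + 1)" if "k \<le> 2 * m" for k
    using that
  proof (induction k)
    case (Suc k)
    then have "A (s + Suc k) + A (s + Suc k + m) + 1 = 2 * (A (s + k) + A (s + k + m) + 1)"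
      using anti[of k] by (simp add: A_def)
    with Suc show ?case by simp
  qed simp
  define n where "n = A s + A (s + m) + 1"
  let ?y = "2 ^ s * (2 ^ m + 1) * x"
  have floors: "of_int (A i) \<le> 2 ^ i * x" "2 ^ i * x \<le> of_int (A i) + 1" for i
    unfolding A_def by linarith+
  have "2 ^ (2 * m) * ?y = 2 ^ (s + 2 * m) * x + 2 ^ (s + 2 * m + m) * x"
    by (simp only: power_add distrib_left distrib_right mult_1_left mult_1_right
        mult.commute mult.left_commute)
  moreover have "of_int (A (s + 2 * m)) + of_int (A (s + 2 * m + m)) + 1 = 2 ^ (2 * m) * real_of_int n"
    using arg_cong[OF sum[of "2 * m"], of real_of_int] by (simp add: n_def)
  \<comment> \<open>The sum of the two reals exceeds the sum of their floors by an amount in [0,2],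
    hence is within 1 of the midpoint \<open>2 ^ (2 * m) * n\<close>.\<close>
  ultimately have "\<bar>2 ^ (2 * m) * ?y - 2 ^ (2 * m) * of_int n\<bar> \<le> 1"
    using floors[of "s + 2 * m"] floors[of "s + 2 * m + m"] by linarith
  then have "2 ^ (2 * m) * \<bar>?y - of_int n\<bar> \<le> 1"
    by (simp add: abs_mult flip: right_diff_distrib)
  then have "\<bar>?y - of_int n\<bar> \<le> 1 / 2 ^ (2 * m)"
    by (simp add: field_simps)
  with infdist_Ints_le[of ?y n] show ?thesis by linarith
qed

lemma complement_block_Littlewood:
  fixes x :: real
  assumes "0 < m" "q = 2 ^ s * (2 ^ m + 1)"
    and "infdist (2 ^ s * (2 ^ m + 1) * x) \<int> \<le> 1 / 2 ^ (2 * m)"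
  shows "real q * padic_abs 2 q * infdist (real q * x) \<int> \<le> 2 * (1 / 2) ^ m"
proof -
  have q: "real q = 2 ^ s * (2 ^ m + 1)"
    by (simp add: assms(2) distrib_left)
  have factor: "real q * padic_abs 2 q = 2 ^ m + 1"
    \<comment> \<open>As \<open>m\<close> is positive, \<open>2 ^ m + 1\<close> is odd, so the
      2-adic factor cancels exactly \<open>2 ^ s\<close>.\<close>
    unfolding assms(2) using assms(1) by (subst padic_abs_power_mult_odd) (auto simp: field_simps)
  have "real q * padic_abs 2 q * infdist (real q * x) \<int> \<le> (2 ^ m + 1) * (1 / 2 ^ (2 * m))"
    unfolding factor using assms(3) by (intro mult_left_mono) (simp_all add: q)
  also have "\<dots> \<le> (2 * 2 ^ m) * (1 / 2 ^ (2 * m))"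
    by (intro mult_right_mono) auto
  also have "\<dots> = 2 * (1 / 2) ^ m"
    by (simp add: power_even_eq power2_eq_square power_one_over)
  finally show ?thesis .
qed

theorem theorem2p13:
  fixes x :: real
  assumes "x \<in> {0..1}"
    and "counterexample_2LC x"
  shows "\<exists>L::nat. \<forall>v. subword v (base_expansion x 2) \<and> overlap_free v \<longrightarrow> length v \<le> L"
proof -
  let ?a = "base_expansion x 2"
  have irr: "x \<notin> \<rat>"
    by (rule counterexample_2LC_irrational[OF assms(2)])
  have digit: "int (?a i) = \<lfloor>2 ^ (i + 1) * x\<rfloor> - 2 * \<lfloor>2 ^ i * x\<rfloor>" "?a i < 2" for i
    using base_expansion_eq_floor[OF irr assms(1), of 2 i] by auto
  obtain c where c: "0 < c"
    "eventually (\<lambda>q. c < real q * padic_abs 2 q * infdist (real q * x) \<int>) sequentially"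
    using counterexample_2LC_bound[OF assms(2)] .
  then obtain Q where Q: "\<And>q. q \<ge> Q \<Longrightarrow> c < real q * padic_abs 2 q * infdist (real q * x) \<int>"
    by (auto simp: eventually_sequentially)
  obtain k0 where k0: "(1 / 2) ^ k0 < c / 2"
    using real_arch_pow_inv[of "c / 2" "1 / 2"] c(1) by auto
  \<comment> \<open>\<open>k0\<close> pushes the product below \<open>c\<close>, while
    \<open>Q\<close> ensures that the denominator \<open>q >= m\<close> is large enough for the
    lower bound \<open>c\<close> to hold.\<close>
  define k where "k = max k0 Q"
  define m :: nat where "m = 2 ^ k"
  have "k < m" "Q \<le> k" "k0 \<le> k"
    unfolding m_def by simp_all (simp_all add: k_def)
  then have m: "0 < m" "Q \<le> m" "k0 \<le> m"
    by auto
  obtain N where N: "\<And>w :: nat \<Rightarrow> bool. overlap_free_upto w N \<Longrightarrow>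
      \<exists>s. s + 3 * m \<le> N \<and> (\<forall>j<2 * m. w (s + j) \<noteq> w (s + j + m))"
    using complement_block_exists[of k] unfolding m_def by blast
  show ?thesis
  proof (intro exI[of _ N] allI impI)
    fix v
    assume "subword v ?a \<and> overlap_free v"
    then obtain i j where v: "v = map ?a [i..<j]" and "overlap_free v"
      by (auto simp: subword_def)
    then have of: "overlap_free_upto (\<lambda>t. ?a (i + t)) (j - i)"
      using overlap_free_imp_upto by blast
    show "length v \<le> N"
    proof (rule ccontr)
      assume "\<not> length v \<le> N"
      then have "overlap_free_upto (\<lambda>t. ?a (i + t)) N"
        using overlap_free_upto_mono[OF of] v by simp
      \<comment> \<open>Digits are 0 or 1, so testing for 1 preserves equality patterns, and
        overlap-freeness passes to the Boolean word.\<close>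
      moreover have "?a s = ?a t \<longleftrightarrow> (?a s = 1) = (?a t = 1)" for s t
        using digit(2)[of s] digit(2)[of t] by auto
      ultimately have "overlap_free_upto (\<lambda>t. ?a (i + t) = 1) N"
        unfolding overlap_free_upto_def by metis
      from N[OF this] obtain s
        where s: "\<And>j. j < 2 * m \<Longrightarrow> (?a (i + (s + j)) = 1) \<noteq> (?a (i + (s + j + m)) = 1)"
        by blast
      have "int (?a (i + s + j)) + int (?a (i + s + j + m)) = 1" if "j < 2 * m" for j
        using s[OF that] digit(2)[of "i + s + j"] digit(2)[of "i + s + j + m"]
        by (auto simp: add.assoc)
      then have "infdist (2 ^ (i + s) * (2 ^ m + 1) * x) \<int> \<le> 1 / 2 ^ (2 * m)"
        unfolding digit(1) by (rule complement_block_approximation)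
      then have "real (2 ^ (i + s) * (2 ^ m + 1)) * padic_abs 2 (2 ^ (i + s) * (2 ^ m + 1)) *
          infdist (real (2 ^ (i + s) * (2 ^ m + 1)) * x) \<int> \<le> 2 * (1 / 2) ^ m"
        using complement_block_Littlewood[OF m(1) refl] by blast
      also have "\<dots> \<le> 2 * (1 / 2) ^ k0"
        using m(3) by (intro mult_left_mono power_decreasing) auto
      also have "\<dots> < c"
        using k0 by simp
      \<comment> \<open>A product below \<open>c\<close> is possible only for \<open>q < Q\<close>,
        whereas \<open>q >= m >= Q\<close>.\<close>
      finally have "2 ^ (i + s) * (2 ^ m + 1) < Q"
        using Q[of "2 ^ (i + s) * (2 ^ m + 1)"] by (meson not_le less_asym)
      moreover have "m \<le> 2 ^ m + 1"
        by (rule order_trans[OF less_imp_le[OF less_exp]]) simp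
      then have "1 * m \<le> 2 ^ (i + s) * (2 ^ m + 1)"
        by (intro mult_le_mono) simp_all
      ultimately show False
        using m(2) by simp
    qed
  qed
qed

end
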